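(* Let $\mathbbm{k}$ be a field and let $\textsf{ParSym}$ be the $\mathbbm{k}$-vector space with basis $\{\textsf{H}_\pi : \pi \in A_i,\ i \in \mathbb{N}_0\}$, graded by $\textsf{ParSym}_i = \operatorname{span}_{\mathbbm{k}}\{\textsf{H}_\pi : \pi \in A_i\}$, with bilinear product determined by $\textsf{H}_\pi \textsf{H}_\rho = \textsf{H}_{\pi \otimes \rho}$ and unit $\textsf{H}_\varnothing$. Then, as a $\mathbbm{k}$-algebra, $\textsf{ParSym}$ is the free associative $\mathbbm{k}$-algebra on the generators $\textsf{H}_\pi$, $\pi$ ranging over the nonempty $\otimes$-irreducible partition diagrams; in particular it is free with $a_k$ generators in each degree $k \geq 1$, where $a_k$ is the number of nonempty $\otimes$-irreducible diagrams in $A_k$.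
   Context: For $k \geq 0$, a partition diagram of order $k$ is a set partition of $\{1,\ldots,k,1',\ldots,k'\}$; $A_k$ is the set of these, and $A_0=\{\varnothing\}$ (the empty diagram). For $\pi \in A_k$ and $\rho \in A_l$, $\pi \otimes \rho \in A_{k+l}$ is the set partition whose blocks are the blocks of $\pi$ together with the blocks of $\rho$ with every $i$ replaced by $i+k$ and every $i'$ by $(i+k)'$. A diagram is $\otimes$-irreducible if it cannot be written as $\rho^{(1)} \otimes \rho^{(2)}$ with $\rho^{(1)},\rho^{(2)}$ nonempty. *)

theory Defs
  imports Complex_Main "HOL-Library.Poly_Mapping" "HOL-Library.Disjoint_Sets"
begin

section \<open>Partition diagrams\<close>

datatype vertex = Unprimed nat | Primed nat

definition vertices :: "nat \<Rightarrow> vertex set" where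
  "vertices k = Unprimed ` {1..k} \<union> Primed ` {1..k}"

typedef pdiagram = "{P. \<exists>k. partition_on (vertices k) P}"
  morphisms blocks Abs_pdiagram
  by (auto simp: vertices_def intro!: exI[of _ "{}"] exI[of _ 0] partition_on_empty[THEN iffD2])

definition diagrams :: "nat \<Rightarrow> pdiagram set" where
  "diagrams k = {\<pi>. partition_on (vertices k) (blocks \<pi>)}"

definition pd_order :: "pdiagram \<Rightarrow> nat" where
  "pd_order \<pi> = (THE k. \<pi> \<in> diagrams k)"

lemma finite_vertices: "finite (vertices k)"
  by (simp add: vertices_def)

lemma vertices_inject: "vertices k = vertices l \<longleftrightarrow> k = l"
proof
  have "{i. Unprimed i \<in> vertices n} = {1..n}" for n
    by (auto simp: vertices_def)
  moreover assume "vertices k = vertices l"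
  ultimately have "{1..k} = {1..l}" by metis
  then have "card {1..k} = card {1..l}" by metis
  then show "k = l" by simp
qed simp

lemma diagrams_unique: "\<pi> \<in> diagrams k \<Longrightarrow> \<pi> \<in> diagrams l \<Longrightarrow> k = l"
  by (metis diagrams_def mem_Collect_eq partition_onD1 vertices_inject)

lemma pd_order_eq: "\<pi> \<in> diagrams k \<Longrightarrow> pd_order \<pi> = k"
  unfolding pd_order_def using diagrams_unique by blast

lemma in_diagrams_pd_order: "\<pi> \<in> diagrams (pd_order \<pi>)"
proof -
  obtain k where "\<pi> \<in> diagrams k"
    using blocks[of \<pi>] by (auto simp: diagrams_def)
  then show ?thesis using pd_order_eq by metis
qed

lemma diagrams_iff: "\<pi> \<in> diagrams k \<longleftrightarrow> pd_order \<pi> = k"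
  using in_diagrams_pd_order pd_order_eq by blast

lemma partition_on_blocks: "partition_on (vertices (pd_order \<pi>)) (blocks \<pi>)"
  using in_diagrams_pd_order by (simp add: diagrams_def)

lemma finite_diagrams: "finite (diagrams k)"
proof -
  have "finite (blocks ` diagrams k)"
    by (rule finite_subset[OF _ finitely_many_partition_on[OF finite_vertices[of k]]])
       (auto simp: diagrams_def)
  then show ?thesis
    by (rule finite_imageD) (auto simp: inj_on_def blocks_inject)
qed

fun shift :: "nat \<Rightarrow> vertex \<Rightarrow> vertex" where
  "shift n (Unprimed i) = Unprimed (i + n)"
| "shift n (Primed i) = Primed (i + n)"

definition tensor :: "pdiagram \<Rightarrow> pdiagram \<Rightarrow> pdiagram" (infixl \<open>\<otimes>\<close> 65) where
  "\<pi> \<otimes> \<rho> = Abs_pdiagram (blocks \<pi> \<union> (`) (shift (pd_order \<pi>)) ` blocks \<rho>)"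

definition empty_diagram :: pdiagram where
  "empty_diagram = Abs_pdiagram {}"

definition tensor_irreducible :: "pdiagram \<Rightarrow> bool" where
  "tensor_irreducible \<pi> \<longleftrightarrow>
     \<not> (\<exists>\<rho>1 \<rho>2. \<rho>1 \<noteq> empty_diagram \<and> \<rho>2 \<noteq> empty_diagram \<and> \<pi> = \<rho>1 \<otimes> \<rho>2)"

lemma inj_shift: "inj (shift n)"
proof (rule injI)
  show "x = y" if "shift n x = shift n y" for x y
    using that by (cases x; cases y) auto
qed

lemma shift_shift: "shift m (shift n v) = shift (m + n) v"
  by (cases v) auto

lemma vertices_add: "vertices (k + l) = vertices k \<union> shift k ` vertices l"
proof -
  have "{1..k + l} = {1..k} \<union> (\<lambda>i. i + k) ` {1..l}"
    by (auto simp: image_iff intro: bexI[of _ "_ - k"])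
  then have "f ` {1..k + l} = f ` {1..k} \<union> (\<lambda>i. f (i + k)) ` {1..l}" for f :: "nat \<Rightarrow> vertex"
    by (simp only: image_Un image_image)
  then show ?thesis
    unfolding vertices_def by (simp only: image_Un image_image shift.simps) blast
qed

lemma vertices_shift_disjoint: "vertices k \<inter> shift k ` vertices l = {}"
  by (auto simp: vertices_def)

lemma partition_on_tensor:
  "partition_on (vertices (pd_order \<pi> + pd_order \<rho>))
     (blocks \<pi> \<union> (`) (shift (pd_order \<pi>)) ` blocks \<rho>)"
proof -
  let ?s = "shift (pd_order \<pi>)"
  have "{} \<notin> (`) ?s ` blocks \<rho>"
    using partition_onD3[OF partition_on_blocks[of \<rho>]] by auto
  with partition_on_inj_image[OF partition_on_blocks[of \<rho>], of ?s] inj_shift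
  have *: "partition_on (?s ` vertices (pd_order \<rho>)) ((`) ?s ` blocks \<rho>)"
    by (metis Diff_empty Diff_insert0 inj_on_subset subset_UNIV)
  note 1 = partition_on_blocks[of \<pi>]
  show ?thesis unfolding vertices_add
  proof (rule partition_onI)
    show "disjnt p q" if "p \<in> blocks \<pi> \<union> (`) ?s ` blocks \<rho>"
      "q \<in> blocks \<pi> \<union> (`) ?s ` blocks \<rho>" "p \<noteq> q" for p q
    proof -
      have A: "disjnt a b" if "a \<in> blocks \<pi>" "b \<in> (`) ?s ` blocks \<rho>" for a b
        using partition_onD1[OF 1] partition_onD1[OF *] that
          vertices_shift_disjoint[of "pd_order \<pi>" "pd_order \<rho>"]
        unfolding disjnt_def by blast
      show ?thesis
        using that A partition_onD2[OF 1] partition_onD2[OF *]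
        by (metis Un_iff disjnt_sym pairwiseD disjnt_def disjointD)
    qed
  qed (use partition_onD1[OF 1] partition_onD1[OF *] partition_onD3[OF 1] partition_onD3[OF *]
       in auto)
qed

lemma blocks_tensor: "blocks (\<pi> \<otimes> \<rho>) = blocks \<pi> \<union> (`) (shift (pd_order \<pi>)) ` blocks \<rho>"
  unfolding tensor_def by (subst Abs_pdiagram_inverse) (use partition_on_tensor in auto)

lemma pd_order_tensor: "pd_order (\<pi> \<otimes> \<rho>) = pd_order \<pi> + pd_order \<rho>"
  using partition_on_tensor[of \<pi> \<rho>] by (intro pd_order_eq) (simp add: diagrams_def blocks_tensor)

lemma tensor_in_diagrams: "\<pi> \<in> diagrams k \<Longrightarrow> \<rho> \<in> diagrams l \<Longrightarrow> \<pi> \<otimes> \<rho> \<in> diagrams (k + l)"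
  by (simp add: diagrams_iff pd_order_tensor)

lemma blocks_empty_diagram: "blocks empty_diagram = {}"
  unfolding empty_diagram_def
  by (subst Abs_pdiagram_inverse) (auto simp: vertices_def partition_on_empty intro: exI[of _ 0])

lemma diagrams_0: "diagrams 0 = {empty_diagram}"
  by (auto simp: diagrams_def vertices_def partition_on_empty blocks_empty_diagram
           simp flip: blocks_inject)

lemma pd_order_eq_0_iff: "pd_order \<pi> = 0 \<longleftrightarrow> \<pi> = empty_diagram"
  using diagrams_0 diagrams_iff by (metis singleton_iff)

text \<open>The additive monoid structure makes the convolution product of \<^theory>\<open>HOL-Library.Poly_Mapping\<close>
  the bilinear extension of \<open>\<otimes>\<close>.\<close>

instantiation pdiagram :: monoid_add
begin

definition zero_pdiagram :: pdiagram where "0 = empty_diagram"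
definition plus_pdiagram :: "pdiagram \<Rightarrow> pdiagram \<Rightarrow> pdiagram" where "\<pi> + \<rho> = \<pi> \<otimes> \<rho>"

instance
proof
  have shift_0: "shift 0 = id"
  proof
    show "shift 0 v = id v" for v by (cases v) auto
  qed
  show "0 + a = a" "a + 0 = a" for a :: pdiagram
    using pd_order_eq_0_iff[of empty_diagram]
    by (simp_all add: zero_pdiagram_def plus_pdiagram_def blocks_tensor blocks_empty_diagram
          shift_0 flip: blocks_inject)
  show "a + b + c = a + (b + c)" for a b c :: pdiagram
    by (simp add: plus_pdiagram_def blocks_tensor pd_order_tensor image_Un image_image
          shift_shift Un_assoc flip: blocks_inject)
qed

end


section \<open>Associative unital algebras and the free algebra\<close>

locale assoc_algebra = vector_space scale
  for scale :: "'k::field \<Rightarrow> 'b::{ring, monoid_mult} \<Rightarrow> 'b" +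
  assumes scale_mult_left: "scale c x * y = scale c (x * y)"
    and scale_mult_right: "x * scale c y = scale c (x * y)"

definition algebra_hom ::
  "('k::field \<Rightarrow> 'b::{ring, monoid_mult} \<Rightarrow> 'b) \<Rightarrow> ('k \<Rightarrow> 'c::{ring, monoid_mult} \<Rightarrow> 'c)
     \<Rightarrow> ('b \<Rightarrow> 'c) \<Rightarrow> bool" where
  "algebra_hom s1 s2 f \<longleftrightarrow>
     Vector_Spaces.linear s1 s2 f \<and> f 1 = 1 \<and> (\<forall>x y. f (x * y) = f x * f y)"

definition pm_scale :: "'k::field \<Rightarrow> ('m \<Rightarrow>\<^sub>0 'k) \<Rightarrow> ('m \<Rightarrow>\<^sub>0 'k)" where
  "pm_scale c p = Poly_Mapping.map ((*) c) p"

lemma lookup_pm_scale: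
  "Poly_Mapping.lookup (pm_scale c p) x = c * Poly_Mapping.lookup p x"
  by (simp add: pm_scale_def Poly_Mapping.map.rep_eq when_def)

lemma vector_space_pm_scale: "vector_space pm_scale"
  by unfold_locales
     (rule poly_mapping_eqI; simp add: lookup_pm_scale lookup_add algebra_simps)+

lemma pm_scale_single: "pm_scale c (Poly_Mapping.single x a) = Poly_Mapping.single x (c * a)"
  by (rule poly_mapping_eqI) (simp add: lookup_pm_scale lookup_single when_def)

lemma poly_mapping_add_single_induct [case_names zero add]:
  assumes "P 0" and "\<And>p x a. P p \<Longrightarrow> P (p + Poly_Mapping.single x a)"
  shows "P (p :: 'm \<Rightarrow>\<^sub>0 'b::comm_monoid_add)"
proof (induction p rule: update_induct)
  case const
  then show ?case using assms(1) by simp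
next
  case (update p x a)
  have "Poly_Mapping.update x a p = p + Poly_Mapping.single x a"
    using update(1)
    by (intro poly_mapping_eqI)
       (auto simp: lookup_update lookup_add lookup_single when_def in_keys_iff)
  with assms(2) update show ?case by metis
qed

lemma pm_scale_eq_mult:
  fixes p :: "'m::monoid_add \<Rightarrow>\<^sub>0 'k::field"
  shows "pm_scale c p = Poly_Mapping.single 0 c * p" "pm_scale c p = p * Poly_Mapping.single 0 c"
proof -
  interpret vector_space "pm_scale :: 'k \<Rightarrow> ('m \<Rightarrow>\<^sub>0 'k) \<Rightarrow> _" by (rule vector_space_pm_scale)
  show "pm_scale c p = Poly_Mapping.single 0 c * p"
    by (induction p rule: poly_mapping_add_single_induct)
       (simp_all add: scale_right_distrib distrib_left mult_single pm_scale_single)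
  show "pm_scale c p = p * Poly_Mapping.single 0 c"
    by (induction p rule: poly_mapping_add_single_induct)
       (simp_all add: scale_right_distrib distrib_right mult_single pm_scale_single mult.commute)
qed

lemma assoc_algebra_pm_scale:
  "assoc_algebra (pm_scale :: 'k::field \<Rightarrow> ('m::monoid_add \<Rightarrow>\<^sub>0 'k) \<Rightarrow> _)"
proof (intro assoc_algebra.intro vector_space_pm_scale assoc_algebra_axioms.intro)
  fix c :: 'k and x y :: "'m \<Rightarrow>\<^sub>0 'k"
  show "pm_scale c x * y = pm_scale c (x * y)"
    by (simp add: pm_scale_eq_mult(1) mult.assoc)
  show "x * pm_scale c y = pm_scale c (x * y)"
    by (simp add: pm_scale_eq_mult(2) mult.assoc)
qed

text \<open>Words: the free monoid, written additively for the sake of the product on \<open>\<Rightarrow>\<^sub>0\<close>.\<close>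

instantiation list :: (type) monoid_add
begin

definition zero_list :: "'a list" where "0 = []"
definition plus_list :: "'a list \<Rightarrow> 'a list \<Rightarrow> 'a list" where "xs + ys = xs @ ys"

instance by standard (simp_all add: zero_list_def plus_list_def)

end

text \<open>Noncommutative polynomials \<open>k\<langle>X\<rangle>\<close>, where the set \<open>X\<close> of variables is the type \<open>'x\<close>:
  finite linear combinations of words, multiplied by bilinear extension of concatenation.\<close>

type_synonym ('x, 'k) free_algebra = "'x list \<Rightarrow>\<^sub>0 'k"

definition free_var :: "'x \<Rightarrow> ('x, 'k::field) free_algebra" where
  "free_var x = Poly_Mapping.single [x] 1"

text \<open>The algebra \<open>'b\<close> is free on the family \<open>g\<close>: the identification \<open>x \<mapsto> g x\<close>
  extends to an isomorphism of algebras from \<open>k\<langle>X\<rangle>\<close>.\<close>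

definition is_free_algebra_on ::
  "('k::field \<Rightarrow> 'b::{ring, monoid_mult} \<Rightarrow> 'b) \<Rightarrow> ('x \<Rightarrow> 'b) \<Rightarrow> bool" where
  "is_free_algebra_on s g \<longleftrightarrow> assoc_algebra s \<and>
     (\<exists>\<Phi> :: ('x, 'k) free_algebra \<Rightarrow> 'b.
        algebra_hom pm_scale s \<Phi> \<and> bij \<Phi> \<and> (\<forall>x. \<Phi> (free_var x) = g x))"


section \<open>The algebra ParSym\<close>

type_synonym 'k parsym = "pdiagram \<Rightarrow>\<^sub>0 'k"

definition H :: "pdiagram \<Rightarrow> 'k::field parsym" where
  "H \<pi> = Poly_Mapping.single \<pi> 1"

definition ParSym_component :: "nat \<Rightarrow> 'k::field parsym set" where
  "ParSym_component i = module.span pm_scale (H ` diagrams i)"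

lemma H_tensor: "H \<pi> * H \<rho> = H (\<pi> \<otimes> \<rho>)"
  by (simp add: H_def mult_single plus_pdiagram_def)

lemma H_empty_diagram: "H empty_diagram = 1"
  by (simp add: H_def flip: zero_pdiagram_def)

interpretation pm: vector_space "pm_scale :: 'k::field \<Rightarrow> ('m \<Rightarrow>\<^sub>0 'k) \<Rightarrow> _"
  by (rule vector_space_pm_scale)

lemma H_inject: "(H \<pi> :: 'k::field parsym) = H \<rho> \<longleftrightarrow> \<pi> = \<rho>"
  by (metis H_def lookup_single_eq lookup_single_not_eq zero_neq_one)

lemma ParSym_component_iff:
  "(p :: 'k::field parsym) \<in> ParSym_component i \<longleftrightarrow> Poly_Mapping.keys p \<subseteq> diagrams i"
proof
  assume "p \<in> ParSym_component i"
  then show "Poly_Mapping.keys p \<subseteq> diagrams i"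
    unfolding ParSym_component_def
  proof (induction rule: pm.span_induct_alt)
    case (step c x y)
    have "Poly_Mapping.keys (pm_scale c x) \<subseteq> Poly_Mapping.keys x"
      by (auto simp: in_keys_iff lookup_pm_scale)
    with step show ?case
      using keys_add[of "pm_scale c x" y] by (fastforce simp: H_def)
  qed simp
next
  assume *: "Poly_Mapping.keys p \<subseteq> diagrams i"
  have "p = (\<Sum>\<pi>\<in>Poly_Mapping.keys p. pm_scale (Poly_Mapping.lookup p \<pi>) (H \<pi>))"
    by (rule poly_mapping_eqI)
       (simp add: lookup_sum lookup_pm_scale H_def lookup_single when_def in_keys_iff
          if_distrib sum.delta cong: if_cong)
  also have "\<dots> \<in> ParSym_component i"
    unfolding ParSym_component_def using *
    by (intro pm.span_sum pm.span_scale pm.span_base) auto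
  finally show "p \<in> ParSym_component i" .
qed

lemma H_in_ParSym_component_iff: "(H \<pi> :: 'k::field parsym) \<in> ParSym_component i \<longleftrightarrow> \<pi> \<in> diagrams i"
  unfolding ParSym_component_iff by (simp add: H_def)

lemma ParSym_component_mult:
  "(p :: 'k::field parsym) \<in> ParSym_component i \<Longrightarrow> q \<in> ParSym_component j
     \<Longrightarrow> p * q \<in> ParSym_component (i + j)"
  unfolding ParSym_component_iff using keys_mult[of p q] tensor_in_diagrams[of _ i _ j]
  by (fastforce simp: plus_pdiagram_def)

typedef irreducible_diagram = "{\<pi>. \<pi> \<noteq> empty_diagram \<and> tensor_irreducible \<pi>}"
  morphisms diagram_of Abs_irreducible_diagram
proof -
  let ?\<pi> = "Abs_pdiagram {vertices 1}"
  have "vertices 1 \<noteq> {}" by (simp add: vertices_def)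
  then have *: "partition_on (vertices 1) {vertices 1}" by (rule partition_on_space)
  then have "blocks ?\<pi> = {vertices 1}"
    by (subst Abs_pdiagram_inverse) auto
  with * have o: "pd_order ?\<pi> = 1" by (intro pd_order_eq) (simp add: diagrams_def)
  have "tensor_irreducible ?\<pi>"
    unfolding tensor_irreducible_def
  proof safe
    fix \<rho>1 \<rho>2 assume "\<rho>1 \<noteq> empty_diagram" "\<rho>2 \<noteq> empty_diagram" "?\<pi> = \<rho>1 \<otimes> \<rho>2"
    then have "pd_order \<rho>1 \<noteq> 0" "pd_order \<rho>2 \<noteq> 0" "1 = pd_order \<rho>1 + pd_order \<rho>2"
      using o by (simp_all add: pd_order_eq_0_iff flip: pd_order_tensor)
    then show False by simp
  qed
  moreover have "?\<pi> \<noteq> empty_diagram" using o pd_order_eq_0_iff by (metis zero_neq_one)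
  ultimately show ?thesis by blast
qed

definition num_irreducible :: "nat \<Rightarrow> nat" where
  "num_irreducible k = card {\<pi> \<in> diagrams k. \<pi> \<noteq> empty_diagram \<and> tensor_irreducible \<pi>}"

end

(* The diagrams form a graded monoid under the tensor product. If a \<otimes> b = c \<otimes> d with a of order
   at most that of c, then the blocks of c that are not blocks of a form, after shifting back, a
   diagram e with c = a \<otimes> e and b = e \<otimes> d. Hence factorizations into irreducibles are unique,
   the monoid of diagrams is free on the nonempty irreducible ones, and so its monoid algebra
   ParSym is the free algebra on them. *)

theory Submission
  imports Defs
begin

section \<open>Cancellation and common refinement in the monoid of diagrams\<close>

lemma blocks_nonempty: "B \<in> blocks \<pi> \<Longrightarrow> B \<noteq> {}"
  using partition_onD3[OF partition_on_blocks] by blast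

lemma blocks_subset_vertices: "B \<in> blocks \<pi> \<Longrightarrow> B \<subseteq> vertices (pd_order \<pi>)"
  using partition_onD1[OF partition_on_blocks] by blast

lemma vertices_mono: "k \<le> l \<Longrightarrow> vertices k \<subseteq> vertices l"
  by (metis le_add_diff_inverse vertices_add Un_upper1)

text \<open>A shifted block is nonempty and uses only vertices beyond the first \<open>k\<close>,
  where \<open>a\<close> has none. So the two families of blocks making up a tensor product never
  overlap, and a factor can be recovered by set difference.\<close>

lemma shifted_block_notin_blocks:
  assumes "pd_order a \<le> k" "B \<in> blocks b"
  shows "shift k ` B \<notin> blocks a"
proof
  assume "shift k ` B \<in> blocks a"
  then have "shift k ` B \<subseteq> vertices k"
    using blocks_subset_vertices vertices_mono[OF assms(1)] by blast
  moreover have "shift k ` B \<subseteq> shift k ` vertices (pd_order b)"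
    using blocks_subset_vertices[OF assms(2)] by blast
  ultimately have "shift k ` B = {}"
    using vertices_shift_disjoint by blast
  then show False using blocks_nonempty[OF assms(2)] by blast
qed

lemma tensor_left_cancel: "a \<otimes> b = a \<otimes> c \<longleftrightarrow> b = c"
proof
  let ?S = "(`) (shift (pd_order a))"
  assume "a \<otimes> b = a \<otimes> c"
  then have eq: "blocks a \<union> ?S ` blocks b = blocks a \<union> ?S ` blocks c"
    by (metis blocks_tensor)
  have "?S ` blocks x = (blocks a \<union> ?S ` blocks x) - blocks a" for x
    using shifted_block_notin_blocks[of a] by auto
  then have "?S ` blocks b = ?S ` blocks c" using eq by metis
  moreover have "inj ?S" using inj_shift by (simp add: inj_def inj_image_eq_iff)
  ultimately show "b = c" by (simp add: inj_image_eq_iff blocks_inject)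
qed simp

lemma tensor_assoc: "a \<otimes> b \<otimes> c = a \<otimes> (b \<otimes> c)"
  using add.assoc[of a b c] by (simp add: plus_pdiagram_def)

lemma tensor_empty_right: "a \<otimes> empty_diagram = a"
  using add.right_neutral[of a] by (simp add: plus_pdiagram_def zero_pdiagram_def)

text \<open>Levi's property of free monoids: two factorizations of one diagram have a common
  refinement. The middle factor \<open>e\<close> is read off from the blocks of \<open>c\<close>
  lying beyond \<open>a\<close>.\<close>

lemma tensor_eq_tensorE:
  assumes eq: "a \<otimes> b = c \<otimes> d" and le: "pd_order a \<le> pd_order c"
  obtains e where "c = a \<otimes> e" "b = e \<otimes> d"
proof -
  define k m where "k = pd_order a" and "m = pd_order c"
  have beq: "blocks a \<union> (`) (shift k) ` blocks b = blocks c \<union> (`) (shift m) ` blocks d"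
    using eq by (metis blocks_tensor k_def m_def)
  \<comment> \<open>Selecting from \<open>blocks b\<close> keeps the middle factor in its own
    coordinates, so no inverse shift is needed.\<close>
  define E where "E = {B \<in> blocks b. shift k ` B \<in> blocks c}"
  \<comment> \<open>By \<open>beq\<close>, a block of \<open>a\<close> could only fail to be in
    \<open>c\<close> by being a block of \<open>d\<close> shifted by \<open>m\<close>; as
    \<open>k\<close> \<le> \<open>m\<close>, this is impossible.\<close>
  have ac: "blocks a \<subseteq> blocks c"
    using beq shifted_block_notin_blocks[of a m] le by (auto simp: m_def)
  with beq have cE: "blocks c = blocks a \<union> (`) (shift k) ` E"
    unfolding E_def by blast
  have "partition_on (vertices (m - k)) E"
  proof (rule partition_onI)
    show "disjnt p q" if "p \<in> E" "q \<in> E" "p \<noteq> q" for p q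
      using that partition_onD2[OF partition_on_blocks[of b]]
      by (auto simp: E_def disjoint_def disjnt_def)
    show "{} \<notin> E"
      using blocks_nonempty by (auto simp: E_def)
    \<comment> \<open>Both \<open>\<Union>E\<close> and \<open>vertices (m - k)\<close>, once
      shifted by \<open>k\<close>, are the complement of \<open>vertices k\<close> in
      \<open>vertices m\<close>; injectivity of the shift makes them equal.\<close>
    have "vertices m = vertices k \<union> shift k ` \<Union>E"
      using partition_onD1[OF partition_on_blocks[of c]] partition_onD1[OF partition_on_blocks[of a]]
      by (simp add: cE k_def m_def image_Union)
    moreover have "vertices m = vertices k \<union> shift k ` vertices (m - k)"
      using vertices_add[of k "m - k"] le by (simp add: k_def m_def)
    moreover have "vertices k \<inter> shift k ` \<Union>E = {}"
    proof -
      have "\<Union>E \<subseteq> vertices (pd_order b)"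
        using blocks_subset_vertices by (auto simp: E_def)
      then show ?thesis using vertices_shift_disjoint by blast
    qed
    moreover have "vertices k \<inter> shift k ` vertices (m - k) = {}"
      by (rule vertices_shift_disjoint)
    ultimately have "shift k ` \<Union>E = shift k ` vertices (m - k)" by blast
    then show "\<Union>E = vertices (m - k)"
      by (simp add: inj_image_eq_iff[OF inj_shift])
  qed
  then have "blocks (Abs_pdiagram E) = E"
    by (subst Abs_pdiagram_inverse) auto
  with cE have c: "c = a \<otimes> Abs_pdiagram E"
    by (simp add: blocks_tensor k_def flip: blocks_inject)
  with eq have "b = Abs_pdiagram E \<otimes> d"
    by (simp add: tensor_assoc tensor_left_cancel)
  with c show thesis by (rule that)
qed

section \<open>Unique factorization into irreducible diagrams\<close>

lemma tensor_irreducible_unique_head: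
  assumes "a \<otimes> b = c \<otimes> d" "tensor_irreducible a" "tensor_irreducible c"
    and "a \<noteq> empty_diagram" "c \<noteq> empty_diagram"
  shows "a = c \<and> b = d"
  using assms
proof (induction "pd_order a" "pd_order c" arbitrary: a b c d rule: linorder_wlog)
  case le
  then obtain e where e: "c = a \<otimes> e" by (metis tensor_eq_tensorE)
  with le have "e = empty_diagram"
    unfolding tensor_irreducible_def by blast
  with e le(2) show ?case by (simp add: tensor_empty_right tensor_left_cancel)
next
  case sym
  then show ?case by metis
qed

text \<open>The canonical monoid homomorphism from the free monoid on the irreducible diagrams;
  \<open>sum_list\<close> is an iterated tensor product, since \<open>+\<close> on diagrams is
  \<open>\<otimes>\<close>.\<close>

definition tensor_word :: "irreducible_diagram list \<Rightarrow> pdiagram" where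
  "tensor_word w = sum_list (map diagram_of w)"

lemma tensor_word_simps [simp]:
  "tensor_word [] = empty_diagram"
  "tensor_word (x # w) = diagram_of x \<otimes> tensor_word w"
  by (simp_all add: tensor_word_def zero_pdiagram_def plus_pdiagram_def)

lemma tensor_word_plus: "tensor_word (v + w) = tensor_word v + tensor_word w"
  by (simp add: tensor_word_def plus_list_def)

lemma tensor_word_zero: "tensor_word 0 = 0"
  by (simp add: zero_list_def zero_pdiagram_def)

lemma diagram_of_nonempty: "diagram_of x \<noteq> empty_diagram"
  and diagram_of_irreducible: "tensor_irreducible (diagram_of x)"
  using diagram_of[of x] by auto

lemma tensor_eq_empty_iff: "a \<otimes> b = empty_diagram \<longleftrightarrow> a = empty_diagram \<and> b = empty_diagram"
  by (simp add: pd_order_tensor flip: pd_order_eq_0_iff)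

text \<open>Uniqueness of factorizations: heads are compared and stripped one letter at a time, and
  a nonempty word never evaluates to the empty diagram.\<close>

lemma inj_tensor_word: "inj tensor_word"
proof (rule injI)
  fix v w assume "tensor_word v = tensor_word w"
  then show "v = w"
  proof (induction v arbitrary: w)
    case Nil
    then have "tensor_word w = empty_diagram" by simp
    then show ?case by (cases w) (simp_all add: tensor_eq_empty_iff diagram_of_nonempty)
  next
    case (Cons x v)
    show ?case
    proof (cases w)
      case Nil
      with Cons.prems show ?thesis by (simp add: tensor_eq_empty_iff diagram_of_nonempty)
    next
      case w: (Cons y w')
      with Cons.prems have "diagram_of x = diagram_of y \<and> tensor_word v = tensor_word w'"
        by (intro tensor_irreducible_unique_head)
           (simp_all add: diagram_of_irreducible diagram_of_nonempty)
      with Cons.IH w show ?thesis by (simp add: diagram_of_inject)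
    qed
  qed
qed

text \<open>Existence of factorizations, by strong induction on the order: orders add, so both
  factors of a proper factorization have smaller order.\<close>

lemma surj_tensor_word: "surj tensor_word"
proof -
  have "\<pi> \<in> range tensor_word" for \<pi>
  proof (induction "pd_order \<pi>" arbitrary: \<pi> rule: less_induct)
    case less
    consider "\<pi> = empty_diagram" | "\<pi> \<noteq> empty_diagram" "tensor_irreducible \<pi>"
      | a b where "a \<noteq> empty_diagram" "b \<noteq> empty_diagram" "\<pi> = a \<otimes> b"
      by (auto simp: tensor_irreducible_def)
    then show ?case
    proof cases
      case 1
      then have "\<pi> = tensor_word []" by simp
      then show ?thesis by (rule range_eqI)
    next
      case 2
      then have "\<pi> = tensor_word [Abs_irreducible_diagram \<pi>]"
        by (simp add: Abs_irreducible_diagram_inverse tensor_empty_right)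
      then show ?thesis by (rule range_eqI)
    next
      case 3
      then have "pd_order a > 0" "pd_order b > 0"
        by (simp_all add: pd_order_eq_0_iff flip: neq0_conv)
      with less 3 obtain v w where "a = tensor_word v" "b = tensor_word w"
        by (metis rangeE pd_order_tensor less_add_same_cancel1 less_add_same_cancel2)
      with 3 have "\<pi> = tensor_word (v + w)" by (simp add: tensor_word_plus plus_pdiagram_def)
      then show ?thesis by (rule range_eqI)
    qed
  qed
  then show ?thesis by blast
qed

section \<open>From monoid isomorphisms to isomorphisms of monoid algebras\<close>

text \<open>\<open>map_key\<close> is precomposition on coefficients, so taking it at
  \<open>inv f\<close> pushes basis elements forward along \<open>f\<close>.\<close>

lemma map_key_inv_single:
  assumes "bij f"
  shows "Poly_Mapping.map_key (inv f) (Poly_Mapping.single x a) = Poly_Mapping.single (f x) a"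
  using map_key_single[OF bij_is_inj[OF bij_imp_bij_inv[OF assms]], of "f x" a]
  by (simp add: inv_f_f[OF bij_is_inj[OF assms]])

lemma bij_map_key:
  assumes "bij f"
  shows "bij (Poly_Mapping.map_key f :: ('b \<Rightarrow>\<^sub>0 'c::zero) \<Rightarrow> ('a \<Rightarrow>\<^sub>0 'c))"
proof (rule o_bij)
  have inj: "inj f" "inj (inv f)"
    using assms bij_imp_bij_inv bij_is_inj by blast+
  have f: "inv f (f x) = x" "f (inv f y) = y" for x y
    using assms by (simp_all add: bij_is_inj bij_is_surj surj_f_inv_f)
  show "Poly_Mapping.map_key (inv f) \<circ> Poly_Mapping.map_key f = (id :: ('b \<Rightarrow>\<^sub>0 'c) \<Rightarrow> _)"
    by (rule ext, rule poly_mapping_eqI) (simp add: map_key.rep_eq inj f)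
  show "Poly_Mapping.map_key f \<circ> Poly_Mapping.map_key (inv f) = (id :: ('a \<Rightarrow>\<^sub>0 'c) \<Rightarrow> _)"
    by (rule ext, rule poly_mapping_eqI) (simp add: map_key.rep_eq inj f)
qed

lemma algebra_hom_map_key_inv:
  fixes f :: "'m::monoid_add \<Rightarrow> 'n::monoid_add"
  assumes bij: "bij f" and zero: "f 0 = 0" and plus: "\<And>x y. f (x + y) = f x + f y"
  shows "algebra_hom pm_scale pm_scale
           (Poly_Mapping.map_key (inv f) :: ('m \<Rightarrow>\<^sub>0 'k::field) \<Rightarrow> ('n \<Rightarrow>\<^sub>0 'k))"
proof -
  define \<Phi> :: "('m \<Rightarrow>\<^sub>0 'k) \<Rightarrow> ('n \<Rightarrow>\<^sub>0 'k)" where "\<Phi> = Poly_Mapping.map_key (inv f)"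
  have inj: "inj (inv f)" using bij bij_imp_bij_inv bij_is_inj by blast
  have single: "\<Phi> (Poly_Mapping.single x a) = Poly_Mapping.single (f x) a" for x a
    unfolding \<Phi>_def by (rule map_key_inv_single[OF bij])
  have add: "\<Phi> (p + q) = \<Phi> p + \<Phi> q" for p q
    unfolding \<Phi>_def by (rule map_key_plus[OF inj])
  have scale: "\<Phi> (pm_scale c p) = pm_scale c (\<Phi> p)" for c p
    by (rule poly_mapping_eqI) (simp add: \<Phi>_def map_key.rep_eq inj lookup_pm_scale)
  have "\<Phi> 0 = 0" using add[of 0 0] by simp
  \<comment> \<open>Multiplicativity is extended from basis elements, where it is
    \<open>plus\<close>, in two stages: first in the right factor, then in the left one.\<close>
  have single_mult: "\<Phi> (Poly_Mapping.single x a * q) = Poly_Mapping.single (f x) a * \<Phi> q" for x a q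
    by (induction q rule: poly_mapping_add_single_induct)
       (simp_all add: \<open>\<Phi> 0 = 0\<close> add single plus distrib_left mult_single)
  have "\<Phi> (p * q) = \<Phi> p * \<Phi> q" for p q
    by (induction p rule: poly_mapping_add_single_induct)
       (simp_all add: \<open>\<Phi> 0 = 0\<close> add single single_mult distrib_right)
  moreover have "\<Phi> 1 = 1"
    using single[of 0 1] by (simp add: zero)
  moreover have "Vector_Spaces.linear pm_scale pm_scale \<Phi>"
    by unfold_locales (rule add scale)+
  ultimately show ?thesis by (simp add: algebra_hom_def \<Phi>_def)
qed

theorem theorem2p7:
  shows "is_free_algebra_on (pm_scale :: 'k::field \<Rightarrow> 'k parsym \<Rightarrow> 'k parsym)
           (\<lambda>\<pi> :: irreducible_diagram. H (diagram_of \<pi>))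
       \<and> range (\<lambda>\<pi>. H (diagram_of \<pi>) :: 'k parsym) \<subseteq> (\<Union>k\<in>{1..}. ParSym_component k)
       \<and> (\<forall>k\<ge>1.
            finite (range (\<lambda>\<pi>. H (diagram_of \<pi>) :: 'k parsym) \<inter> ParSym_component k)
          \<and> card (range (\<lambda>\<pi>. H (diagram_of \<pi>) :: 'k parsym) \<inter> ParSym_component k)
              = num_irreducible k)"
proof (intro conjI allI impI)
  let ?\<Phi> = "Poly_Mapping.map_key (inv tensor_word) ::
    (irreducible_diagram, 'k) free_algebra \<Rightarrow> 'k parsym"
  have bij: "bij tensor_word"
    using inj_tensor_word surj_tensor_word by (rule bijI)
  have "\<forall>x. ?\<Phi> (free_var x) = H (diagram_of x)"
    by (simp add: free_var_def H_def map_key_inv_single[OF bij] tensor_empty_right)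
  then show "is_free_algebra_on (pm_scale :: 'k \<Rightarrow> 'k parsym \<Rightarrow> 'k parsym)
      (\<lambda>\<pi>. H (diagram_of \<pi>))"
    unfolding is_free_algebra_on_def
    using assoc_algebra_pm_scale bij_map_key[OF bij_imp_bij_inv[OF bij]]
      algebra_hom_map_key_inv[OF bij tensor_word_zero tensor_word_plus]
    by blast
next
  have "pd_order (diagram_of \<pi>) \<ge> 1" for \<pi>
    using diagram_of_nonempty[of \<pi>] by (metis pd_order_eq_0_iff less_one not_le)
  then show "range (\<lambda>\<pi>. H (diagram_of \<pi>) :: 'k parsym) \<subseteq> (\<Union>k\<in>{1..}. ParSym_component k)"
    by (force simp: H_in_ParSym_component_iff diagrams_iff)
next
  fix k :: nat
  let ?A = "{\<pi> \<in> diagrams k. \<pi> \<noteq> empty_diagram \<and> tensor_irreducible \<pi>}"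
  \<comment> \<open>As \<open>H\<close> is injective and \<open>H \<pi>\<close> has degree
    \<open>k\<close> exactly when \<pi> has order \<open>k\<close>, counting generators reduces to
    counting diagrams.\<close>
  have eq: "range (\<lambda>\<pi>. H (diagram_of \<pi>) :: 'k parsym) \<inter> ParSym_component k = H ` ?A"
  proof -
    have "range (\<lambda>\<pi>. H (diagram_of \<pi>) :: 'k parsym) = H ` range diagram_of"
      by (simp add: image_image)
    also have "range diagram_of = {\<pi>. \<pi> \<noteq> empty_diagram \<and> tensor_irreducible \<pi>}"
      using type_definition.Rep_range[OF type_definition_irreducible_diagram] .
    finally show ?thesis by (auto simp: H_in_ParSym_component_iff)
  qed
  show "finite (range (\<lambda>\<pi>. H (diagram_of \<pi>) :: 'k parsym) \<inter> ParSym_component k)"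
    unfolding eq using finite_diagrams by auto
  show "card (range (\<lambda>\<pi>. H (diagram_of \<pi>) :: 'k parsym) \<inter> ParSym_component k)
      = num_irreducible k"
    unfolding eq num_irreducible_def by (rule card_image) (simp add: inj_on_def H_inject)
qed

end
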